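(* Let $2\le s<d$. Assume that $\mathbf{P}_\eta(L_i\ne L_j,\ \forall i\ne j)=1$ for all $\eta\in\{0,1\}^d$ with $|\eta|_0=s$. Then $$\frac{1}{2}\,\mathbf{E}_{e(s)} |\hat{\eta}^{(s)} - e(s)| \;\leq\; \inf_{\tilde{\eta}} \sup_{|\eta|_{0} = s} \mathbf{E}_{\eta} |\tilde{\eta} - \eta| \;\leq\; \mathbf{E}_{e(s)} |\hat{\eta}^{(s)} - e(s)|,$$ where $\hat\eta^{(s)}$ is the scan selector, $e(s)=(1,\dots,1,0,\dots,0)$ is the vector with $s$ ones followed by $d-s$ zeros, and $\inf_{\tilde\eta}$ is the infimum over all selectors.
   Context: Pivotal selection problem: $d>2$ and $1\le s<d$ are integers; $P_0\neq P_1$ are probability measures on a measurable space with densities $f_0,f_1$ with respect to a common dominating measure $\mu$. For $\eta\in\{0,1\}^d$, under $\mathbf{P}_\eta$ the observations $X_1,\dots,X_d$ are independent, with $X_j\sim P_1$ if $\eta_j=1$ and $X_j\sim P_0$ if $\eta_j=0$; $\mathbf{E}_\eta$ is the corresponding expectation. A selector is any measurable function $\tilde\eta=\tilde\eta(X_1,\dots,X_d,\zeta)$ with values in $\{0,1\}^d$, where $\zeta$ is a randomization variable independent of $(X_1,\dots,X_d)$. $|\tilde\eta-\eta|=\sum_{j=1}^d\mathbf{1}(\tilde\eta_j\ne\eta_j)$; $|\eta|_0$ is the number of non-zero components of $\eta$; $\sup_{|\eta|_0=s}$ is over $\eta\in\{0,1\}^d$ with $|\eta|_0=s$. Likelihood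 ratios $L_i=\frac{f_1}{f_0}(X_i)$ are assumed to be well defined $\mathbf{P}_\eta$-a.s. for any $\eta$ (this is the case if the support of $f_1$ is included in the support of $f_0$). Let $L_{(1)}\ge\dots\ge L_{(d)}$ be the ordered values of $L_1,\dots,L_d$ and $\mathbb{L}_{1:s}=\{L_{(1)},\dots,L_{(s)}\}$ the set of the $s$ largest values. The scan selector is $\hat\eta^{(s)}=(\hat\eta^{(s)}_1,\dots,\hat\eta^{(s)}_d)$ with $\hat\eta^{(s)}_i=\mathbf{1}(L_i\in\mathbb{L}_{1:s})$. *)

theory Defs
  imports "HOL-Probability.Probability"
begin

text \<open>Vectors indexed by \<open>{1..d}\<close> are extensional functions on \<open>{1..d}\<close>, so that the sample space is
  the space of the library's product measure \<^const>\<open>PiM\<close>.\<close>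

definition binary_vectors :: "nat \<Rightarrow> (nat \<Rightarrow> nat) set" where
  "binary_vectors d = ({1..d} \<rightarrow>\<^sub>E {0, 1})"

definition num_nonzero :: "nat \<Rightarrow> (nat \<Rightarrow> nat) \<Rightarrow> nat" where
  "num_nonzero d \<eta> = card {j \<in> {1..d}. \<eta> j \<noteq> 0}"

definition hamming :: "nat \<Rightarrow> (nat \<Rightarrow> nat) \<Rightarrow> (nat \<Rightarrow> nat) \<Rightarrow> real" where
  "hamming d \<eta> \<eta>' = (\<Sum>j = 1..d. of_bool (\<eta> j \<noteq> \<eta>' j))"

definition first_ones :: "nat \<Rightarrow> nat \<Rightarrow> nat \<Rightarrow> nat" where
  "first_ones d s = (\<lambda>j\<in>{1..d}. if j \<le> s then 1 else 0)"

definition obs_law :: "nat \<Rightarrow> 'a measure \<Rightarrow> 'a measure \<Rightarrow> (nat \<Rightarrow> nat) \<Rightarrow> (nat \<Rightarrow> 'a) measure" where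
  "obs_law d P0 P1 \<eta> = PiM {1..d} (\<lambda>j. if \<eta> j = 1 then P1 else P0)"

text \<open>A selector comes with the law \<open>Z\<close> of its own randomization variable.  Independence of the
  observations and the randomization is expressed by the product measure in \<open>selector_risk\<close>.
  The measure \<open>M\<close> below only supplies the measurable space of a single observation.\<close>

type_synonym ('a, 'z) selector = "'z measure \<times> ((nat \<Rightarrow> 'a) \<times> 'z \<Rightarrow> nat \<Rightarrow> nat)"

definition selectors :: "nat \<Rightarrow> 'a measure \<Rightarrow> ('a, 'z) selector set" where
  "selectors d M = {(Z, \<phi>). prob_space Z \<and>
     \<phi> \<in> (PiM {1..d} (\<lambda>_. M) \<Otimes>\<^sub>M Z) \<rightarrow>\<^sub>M count_space (binary_vectors d)}"

definition selector_risk ::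
    "nat \<Rightarrow> 'a measure \<Rightarrow> 'a measure \<Rightarrow> (nat \<Rightarrow> nat) \<Rightarrow> ('a, 'z) selector \<Rightarrow> real" where
  "selector_risk d P0 P1 \<eta> = (\<lambda>(Z, \<phi>).
     (\<integral>w. hamming d (\<phi> w) \<eta> \<partial>(obs_law d P0 P1 \<eta> \<Otimes>\<^sub>M Z)))"

definition lik_ratio :: "('a \<Rightarrow> real) \<Rightarrow> ('a \<Rightarrow> real) \<Rightarrow> (nat \<Rightarrow> 'a) \<Rightarrow> nat \<Rightarrow> real" where
  "lik_ratio f0 f1 x i = f1 (x i) / f0 (x i)"

definition s_largest :: "nat \<Rightarrow> nat \<Rightarrow> (nat \<Rightarrow> real) \<Rightarrow> real set" where
  "s_largest d s L = set (take s (rev (sort (map L [1..<Suc d]))))"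

definition scan_selector ::
    "nat \<Rightarrow> nat \<Rightarrow> ('a \<Rightarrow> real) \<Rightarrow> ('a \<Rightarrow> real) \<Rightarrow> (nat \<Rightarrow> 'a) \<Rightarrow> nat \<Rightarrow> nat" where
  "scan_selector d s f0 f1 x =
     (\<lambda>i\<in>{1..d}. of_bool (lik_ratio f0 f1 x i \<in> s_largest d s (lik_ratio f0 f1 x)))"

end

(* Under P_eta the observations have density prod_{eta_j = 1} L_j with respect to the law in which
   all of them come from P0.  By symmetry the scan selector has the same risk under every eta with s
   ones, which gives the upper bound.  For the lower bound, replace the supremum by the average over
   these eta: given x, the posterior weight of the support A is proportional to prod_{j in A} L_j.
   Its marginals are increasing in L_j, so among sets of size s the s largest L_j have the smallest
   posterior loss.  An arbitrary set V is at distance ||V| - s| from some set U of size s, which is at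
   most its distance to any support of size s, so the triangle inequality costs a factor 2. *)
theory Submission imports Defs begin

section \<open>Ranks and the set of the \<open>s\<close> largest values\<close>

text \<open>In a descending list the entries above \<open>v\<close> form a prefix, and the first
  occurrence of \<open>v\<close>, if any, comes directly after it. Its position is therefore the
  number of strictly larger entries.\<close>

lemma mem_take_iff_card_greater:
  fixes xs :: "'b::linorder list"
  assumes "sorted_wrt (\<ge>) xs"
  shows "v \<in> set (take n xs) \<longleftrightarrow> v \<in> set xs \<and> length (filter (\<lambda>y. v < y) xs) < n"
  using assms
proof (induction xs arbitrary: n)
  case (Cons x xs)
  show ?case
  proof (cases n)
    case (Suc m)
    show ?thesis
    proof (cases "v < x")
      case True
      then show ?thesis using Cons.IH[of m] Cons.prems Suc by auto
    next
      case False
      then have "filter (\<lambda>y. v < y) xs = []"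
        using Cons.prems by (auto simp: filter_empty_conv)
      moreover have "v = x \<or> v \<notin> set xs"
        using False Cons.prems by force
      ultimately show ?thesis using False Suc by (auto dest: in_set_takeD)
    qed
  qed auto
qed auto

text \<open>Replaces the sorted list by a count of strictly larger coordinates. This form is
  measurable in the data and shows at once that selection is monotone in \<open>L i\<close>.\<close>

lemma mem_s_largest_iff:
  assumes "i \<in> {1..d}"
  shows "L i \<in> s_largest d s L \<longleftrightarrow> card {j \<in> {1..d}. L i < L j} < s"
proof -
  let ?xs = "map L [1..<Suc d]"
  have "sorted_wrt (\<ge>) (rev (sort ?xs))"
    by (simp add: sorted_wrt_rev)
  moreover have "length (filter (\<lambda>y. L i < y) (rev (sort ?xs))) = card {j \<in> {1..d}. L i < L j}"
  proof -
    have "length (filter (\<lambda>y. L i < y) (rev (sort ?xs))) = size (filter_mset (\<lambda>y. L i < y) (mset ?xs))"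
      by (simp only: size_mset[symmetric] mset_filter mset_rev mset_sort)
    also have "\<dots> = length (filter (\<lambda>y. L i < y) ?xs)"
      by (simp only: size_mset[symmetric] mset_filter)
    also have "\<dots> = length (filter (\<lambda>j. L i < L j) [1..<Suc d])"
      by (simp only: filter_map length_map comp_def)
    also have "\<dots> = card (set (filter (\<lambda>j. L i < L j) [1..<Suc d]))"
      by (rule distinct_card[symmetric]) (rule distinct_filter[OF distinct_upt])
    also have "set (filter (\<lambda>j. L i < L j) [1..<Suc d]) = {j \<in> {1..d}. L i < L j}"
      by auto
    finally show ?thesis .
  qed
  moreover have "L i \<in> set ?xs" using assms by (auto simp del: upt_Suc)
  ultimately show ?thesis
    unfolding s_largest_def by (simp only: mem_take_iff_card_greater set_rev set_sort simp_thms)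
qed

lemma s_largest_cong:
  assumes "\<And>i. i \<in> {1..d} \<Longrightarrow> L i = L' i"
  shows "s_largest d s L = s_largest d s L'"
proof -
  have "map L [1..<Suc d] = map L' [1..<Suc d]" using assms by (intro map_cong) auto
  then show ?thesis unfolding s_largest_def by (simp only:)
qed

text \<open>Injectivity makes the sorted values distinct and gives each of the \<open>s\<close>
  retained values exactly one index; with ties more than \<open>s\<close> indices could
  qualify.\<close>

lemma card_top_indices:
  assumes "inj_on L {1..d}" "s \<le> d"
  shows "card {i \<in> {1..d}. L i \<in> s_largest d s L} = s"
proof -
  let ?A = "s_largest d s L"
  have sub: "?A \<subseteq> L ` {1..d}"
  proof -
    have "?A \<subseteq> set (rev (sort (map L [1..<Suc d])))"
      unfolding s_largest_def by (rule set_take_subset)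
    then show ?thesis by (simp only: set_rev set_sort set_map set_upt atLeastLessThanSuc_atLeastAtMost)
  qed
  have "distinct (map L [1..<Suc d])"
    using assms(1) by (simp only: distinct_map set_upt atLeastLessThanSuc_atLeastAtMost distinct_upt simp_thms)
  then have "distinct (rev (sort (map L [1..<Suc d])))"
    by (simp only: distinct_rev distinct_sort)
  from distinct_card[OF distinct_take[OF this, of s]] have "card ?A = s"
    using assms(2) unfolding s_largest_def by (simp del: upt_Suc)
  moreover have "L ` {i \<in> {1..d}. L i \<in> ?A} = ?A" using sub by blast
  moreover have "inj_on L {i \<in> {1..d}. L i \<in> ?A}"
    using assms(1) by (rule inj_on_subset) auto
  ultimately show ?thesis using card_image[of L "{i \<in> {1..d}. L i \<in> ?A}"] by simp
qed

subsection \<open>Posterior Hamming loss\<close>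

text \<open>Sets containing both indices contribute equally to the two sides. A set containing only
  \<open>j\<close> is matched with the one where \<open>j\<close> is exchanged for \<open>i\<close>,
  which trades the factor \<open>a j\<close> for \<open>a i\<close>. For likelihood ratios the sums
  are posterior inclusion probabilities up to a common normalisation.\<close>

lemma sum_prod_mono_index:
  fixes a :: "'i \<Rightarrow> real"
  assumes "finite I" and nonneg: "\<And>k. k \<in> I \<Longrightarrow> 0 \<le> a k"
    and ij: "i \<in> I" "j \<in> I" "a j \<le> a i"
  shows "(\<Sum>A | A \<subseteq> I \<and> card A = s \<and> j \<in> A. prod a A) \<le> (\<Sum>A | A \<subseteq> I \<and> card A = s \<and> i \<in> A. prod a A)"
proof (cases "i = j")
  case False
  let ?S = "\<lambda>k l. {A. A \<subseteq> I \<and> card A = s \<and> k \<in> A \<and> l \<notin> A}"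
  let ?B = "{A. A \<subseteq> I \<and> card A = s \<and> i \<in> A \<and> j \<in> A}"
  have fin: "finite {A. A \<subseteq> I \<and> P A}" for P using \<open>finite I\<close> by simp
  have split: "(\<Sum>A | A \<subseteq> I \<and> card A = s \<and> k \<in> A. prod a A) = sum (prod a) (?S k l) + sum (prod a) ?B"
    if "{k, l} = {i, j}" for k l
  proof -
    have "{A. A \<subseteq> I \<and> card A = s \<and> k \<in> A} = ?S k l \<union> ?B" using that by (auto simp: doubleton_eq_iff)
    moreover have "?S k l \<inter> ?B = {}" using that by (auto simp: doubleton_eq_iff)
    ultimately show ?thesis using fin by (simp add: sum.union_disjoint)
  qed
  have fA: "finite A" if "A \<subseteq> I" for A using that \<open>finite I\<close> finite_subset by blast
  \<comment> \<open>Simplification turns the size of a set after an exchange into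
    \<open>Suc (card A - Suc 0)\<close>; the membership \<open>k \<in> A\<close> rules out
    \<open>card A = 0\<close>, where truncated subtraction would spoil the equality.\<close>
  have pos: "Suc (card A - Suc 0) = card A" if "A \<subseteq> I" "k \<in> A" for A k
    using fA that by (metis One_nat_def Suc_pred' card_gt_0_iff empty_iff)
  have bij: "bij_betw (\<lambda>A. insert i (A - {j})) (?S j i) (?S i j)"
    by (rule bij_betwI[where g = "\<lambda>A. insert j (A - {i})"])
       (use ij False fA in \<open>auto simp: pos[of _ i] pos[of _ j]\<close>)
  have "sum (prod a) (?S j i) \<le> (\<Sum>A\<in>?S j i. prod a (insert i (A - {j})))"
  proof (rule sum_mono)
    fix A assume A: "A \<in> ?S j i"
    have "prod a A = a j * prod a (A - {j})"
      using A fA by (intro prod.remove) auto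
    also have "\<dots> \<le> a i * prod a (A - {j})"
      using A nonneg ij by (intro mult_right_mono prod_nonneg) auto
    also have "\<dots> = prod a (insert i (A - {j}))"
      using A fA by simp
    finally show "prod a A \<le> prod a (insert i (A - {j}))" .
  qed
  also have "\<dots> = sum (prod a) (?S i j)"
    using sum.reindex_bij_betw[OF bij] .
  finally show ?thesis using split[OF refl] split[OF insert_commute] by linarith
qed simp

text \<open>The common part \<open>U \<inter> T\<close> cancels. The two differences have equal
  size, so a bijection pairs each element of \<open>U - T\<close> with one of \<open>T - U\<close>
  that weighs at least as much.\<close>

lemma sum_le_sum_top_set:
  fixes p :: "'i \<Rightarrow> real"
  assumes fin: "finite T" "finite U" and card: "card T = card U"
    and top: "\<And>i j. i \<in> T - U \<Longrightarrow> j \<in> U - T \<Longrightarrow> p j \<le> p i"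
  shows "sum p U \<le> sum p T"
proof -
  have "card (U - T) = card (T - U)"
    using fin card by (simp add: card_Diff_subset_Int Int_commute)
  then obtain g where g: "bij_betw g (U - T) (T - U)"
    using fin by (metis finite_Diff finite_same_card_bij)
  have "sum p (U - T) \<le> (\<Sum>u\<in>U - T. p (g u))"
    using g by (intro sum_mono top) (auto dest: bij_betw_apply)
  also have "\<dots> = sum p (T - U)" using sum.reindex_bij_betw[OF g] .
  finally have "sum p (U - T) \<le> sum p (T - U)" .
  moreover have "sum p U = sum p (U - T) + sum p (U \<inter> T)"
    using sum.Int_Diff[OF fin(2), of p T] by simp
  moreover have "sum p T = sum p (T - U) + sum p (U \<inter> T)"
    using sum.Int_Diff[OF fin(1), of p U] by (simp add: inf_commute)
  ultimately show ?thesis by simp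
qed

section \<open>Symmetric differences and the finite loss inequality\<close>

lemma card_sym_diff_triangle:
  assumes "finite A" "finite B" "finite C"
  shows "card (sym_diff A C) \<le> card (sym_diff A B) + card (sym_diff B C)"
proof -
  have "card (sym_diff A C) \<le> card (sym_diff A B \<union> sym_diff B C)"
    using assms by (intro card_mono) auto
  also have "\<dots> \<le> card (sym_diff A B) + card (sym_diff B C)" by (rule card_Un_le)
  finally show ?thesis .
qed

lemma card_sym_diff_eq:
  assumes "finite A" "finite B"
  shows "real (card (sym_diff A B)) = real (card A) + real (card B) - 2 * real (card (A \<inter> B))"
proof -
  have "card (sym_diff A B) = card (A - B) + card (B - A)"
    using assms by (intro card_Un_disjoint) auto
  moreover have "card A = card (A - B) + card (A \<inter> B)" 
    using assms card_Int_Diff[of A B] by simp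
  moreover have "card B = card (B - A) + card (A \<inter> B)"
    using assms card_Int_Diff[of B A] by (simp add: inf_commute)
  ultimately show ?thesis by simp
qed

text \<open>Adding elements to \<open>V\<close> or removing some until \<open>s\<close> remain costs
  exactly the discrepancy between \<open>card V\<close> and \<open>s\<close>, and every set of size
  \<open>s\<close> is at least that far from \<open>V\<close>.\<close>

lemma nearest_subset_of_card:
  assumes "finite I" "V \<subseteq> I" "s \<le> card I"
  obtains U where "U \<subseteq> I" "card U = s"
    "\<And>A. A \<subseteq> I \<Longrightarrow> card A = s \<Longrightarrow> card (sym_diff U V) \<le> card (sym_diff V A)"
proof -
  have fV: "finite V" using assms finite_subset by blast
  \<comment> \<open>Since subtraction on \<open>nat\<close> is truncated, one of the two bounds is
    trivial; together they bound the distance below by the absolute difference of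
    \<open>card V\<close> and \<open>s\<close>.\<close>
  have diff: "card V - s \<le> card (sym_diff V A)" "s - card V \<le> card (sym_diff V A)"
    if "A \<subseteq> I" "card A = s" for A
  proof -
    have fA: "finite A" using that assms finite_subset by blast
    have "card V - card A \<le> card (V - A)" by (rule diff_card_le_card_Diff[OF fA])
    also have "\<dots> \<le> card (sym_diff V A)" using fA fV by (intro card_mono) auto
    finally show "card V - s \<le> card (sym_diff V A)" using that by simp
    have "card A - card V \<le> card (A - V)" by (rule diff_card_le_card_Diff[OF fV])
    also have "\<dots> \<le> card (sym_diff V A)" using fA fV by (intro card_mono) auto
    finally show "s - card V \<le> card (sym_diff V A)" using that by simp
  qed
  show thesis
  proof (cases "card V \<le> s")
    case True
    then obtain U where U: "V \<subseteq> U" "U \<subseteq> I" "card U = s"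
      using exists_subset_between[of V s I] assms by auto
    then have "sym_diff U V = U - V" by auto
    then have "card (sym_diff U V) = s - card V" using U fV by (simp add: card_Diff_subset)
    then show thesis using that U diff by auto
  next
    case False
    then obtain U where U: "U \<subseteq> V" "card U = s" "finite U"
      using obtain_subset_with_card_n[of s V] by auto
    then have "sym_diff U V = V - U" by auto
    then have "card (sym_diff U V) = card V - s" using U by (simp add: card_Diff_subset)
    then show thesis using that[of U] U diff assms by auto
  qed
qed

text \<open>The Bayesian comparison for one fixed sample: \<open>a\<close> stands for the likelihood
  ratios, \<open>T\<close> for the scan set, \<open>V\<close> for the set chosen by a competitor,
  and \<open>prod a A\<close> for the posterior weight of the support \<open>A\<close>. Leaving the
  weights unnormalised avoids a division by a total that may be zero.\<close>

lemma top_set_loss_le_twice: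
  fixes a :: "'i \<Rightarrow> real"
  assumes "finite I" and nonneg: "\<And>k. k \<in> I \<Longrightarrow> 0 \<le> a k"
    and T: "T \<subseteq> I" "card T = s"
    and top: "\<And>i j. i \<in> T \<Longrightarrow> j \<in> I - T \<Longrightarrow> a j \<le> a i"
    and V: "V \<subseteq> I"
  shows "(\<Sum>A | A \<subseteq> I \<and> card A = s. prod a A * real (card (sym_diff T A)))
       \<le> 2 * (\<Sum>A | A \<subseteq> I \<and> card A = s. prod a A * real (card (sym_diff V A)))"
proof -
  let ?F = "{A. A \<subseteq> I \<and> card A = s}"
  \<comment> \<open>The unnormalised posterior probability that \<open>i\<close> belongs to the
    support.\<close>
  define p where "p = (\<lambda>i. \<Sum>A | A \<subseteq> I \<and> card A = s \<and> i \<in> A. prod a A)"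
  have fin: "finite ?F" using \<open>finite I\<close> by simp
  have fA: "finite A" if "A \<subseteq> I" for A using that \<open>finite I\<close> finite_subset by blast
  have w: "0 \<le> prod a A" if "A \<subseteq> I" for A using that nonneg by (intro prod_nonneg) auto
  have "s \<le> card I" using T \<open>finite I\<close> card_mono by blast
  then obtain U where U: "U \<subseteq> I" "card U = s"
      and near: "\<And>A. A \<subseteq> I \<Longrightarrow> card A = s \<Longrightarrow> card (sym_diff U V) \<le> card (sym_diff V A)"
    using nearest_subset_of_card[OF \<open>finite I\<close> V] by metis
  \<comment> \<open>For two sets of size \<open>s\<close> the distance is
    \<open>2 * s - 2 * card (B \<inter> A)\<close>, and double counting turns the weighted sum of
    \<open>card (B \<inter> A)\<close> into \<open>sum p B\<close>. Minimising the loss among sets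
    of size \<open>s\<close> thus means maximising \<open>sum p B\<close>.\<close>
  have loss: "(\<Sum>A\<in>?F. prod a A * real (card (sym_diff B A))) = 2 * s * sum (prod a) ?F - 2 * sum p B"
    if B: "B \<subseteq> I" "card B = s" for B
  proof -
    have "(\<Sum>A\<in>?F. prod a A * real (card (B \<inter> A))) = (\<Sum>A\<in>?F. \<Sum>i\<in>B. if i \<in> A then prod a A else 0)"
      using fA[OF B(1)] by (intro sum.cong) (auto simp: sum.inter_restrict[symmetric] mult.commute)
    also have "\<dots> = (\<Sum>i\<in>B. \<Sum>A\<in>?F. if i \<in> A then prod a A else 0)" by (rule sum.swap)
    also have "\<dots> = sum p B"
      using fin by (simp add: p_def sum.inter_filter[symmetric] conj_assoc)
    finally have *: "(\<Sum>A\<in>?F. prod a A * real (card (B \<inter> A))) = sum p B" .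
    have "(\<Sum>A\<in>?F. prod a A * real (card (sym_diff B A)))
        = (\<Sum>A\<in>?F. 2 * s * prod a A - 2 * (prod a A * real (card (B \<inter> A))))"
    proof (rule sum.cong[OF refl])
      fix A assume "A \<in> ?F"
      then have "real (card (sym_diff B A)) = 2 * s - 2 * real (card (B \<inter> A))"
        using card_sym_diff_eq[OF fA[OF B(1)] fA[of A]] B(2) by simp
      then show "prod a A * real (card (sym_diff B A)) = 2 * s * prod a A - 2 * (prod a A * real (card (B \<inter> A)))"
        by (simp only: right_diff_distrib mult.left_commute mult.commute mult.assoc)
    qed
    also have "\<dots> = 2 * s * sum (prod a) ?F - 2 * sum p B"
      by (simp add: sum_subtractf sum_distrib_left[symmetric] *)
    finally show ?thesis .
  qed
  have "sum p U \<le> sum p T"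
  proof (rule sum_le_sum_top_set)
    fix i j assume "i \<in> T - U" "j \<in> U - T"
    then show "p j \<le> p i"
      unfolding p_def using T U top by (intro sum_prod_mono_index[OF \<open>finite I\<close> nonneg]) auto
  qed (use T U fA in auto)
  then have "(\<Sum>A\<in>?F. prod a A * real (card (sym_diff T A))) \<le> (\<Sum>A\<in>?F. prod a A * real (card (sym_diff U A)))"
    using loss[OF T] loss[OF U] by simp
  \<comment> \<open>The factor 2 arises here: going from \<open>U\<close> to \<open>A\<close>
    through \<open>V\<close>, the first leg is at most the second by \<open>near\<close>.\<close>
  also have "\<dots> \<le> (\<Sum>A\<in>?F. 2 * (prod a A * real (card (sym_diff V A))))"
  proof (rule sum_mono)
    fix A assume A: "A \<in> ?F"
    then have "card (sym_diff U A) \<le> 2 * card (sym_diff V A)"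
      using card_sym_diff_triangle[OF fA[OF U(1)] fA[OF V] fA[of A]] near[of A] by simp
    then have "real (card (sym_diff U A)) \<le> 2 * real (card (sym_diff V A))" by linarith
    from mult_left_mono[OF this w] A
    show "prod a A * real (card (sym_diff U A)) \<le> 2 * (prod a A * real (card (sym_diff V A)))"
      by (simp add: mult.left_commute)
  qed
  finally show ?thesis by (simp add: sum_distrib_left)
qed

subsection \<open>Densities of product measures\<close>

text \<open>A finite product measure is determined by its values on boxes. There the integrand
  splits into functions of single coordinates, so the integral is the product of the one-dimensional
  integrals.\<close>

lemma PiM_density:
  fixes g :: "'i \<Rightarrow> 'b \<Rightarrow> ennreal"
  assumes "finite I" "sigma_finite_measure M"
    and g: "\<And>i. i \<in> I \<Longrightarrow> g i \<in> borel_measurable M"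
    and sf: "\<And>i. i \<in> I \<Longrightarrow> sigma_finite_measure (density M (g i))"
  shows "PiM I (\<lambda>i. density M (g i)) = density (PiM I (\<lambda>_. M)) (\<lambda>x. \<Prod>i\<in>I. g i (x i))"
proof -
  \<comment> \<open>The locale \<open>product_sigma_finite\<close> asks for sigma-finiteness at
    every index, so the factors outside \<open>I\<close> are set to \<open>M\<close>.\<close>
  define N where "N = (\<lambda>i. if i \<in> I then density M (g i) else M)"
  interpret N: product_sigma_finite N
    unfolding product_sigma_finite_def N_def using sf assms(2) by simp
  interpret M: product_sigma_finite "\<lambda>_. M"
    unfolding product_sigma_finite_def using assms(2) by simp
  have "density (PiM I (\<lambda>_. M)) (\<lambda>x. \<Prod>i\<in>I. g i (x i)) = PiM I N"
  proof (rule N.PiM_eqI[OF \<open>finite I\<close>])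
    have "sets (PiM I N) = sets (PiM I (\<lambda>_. M))"
      by (rule sets_PiM_cong) (auto simp: N_def)
    then show "sets (density (PiM I (\<lambda>_. M)) (\<lambda>x. \<Prod>i\<in>I. g i (x i))) = sets (PiM I N)" by simp
    fix A assume A: "\<And>i. i \<in> I \<Longrightarrow> A i \<in> sets (N i)"
    have A_meas: "A i \<in> sets M" if "i \<in> I" for i using A[OF that] that by (simp add: N_def)
    have box: "Pi\<^sub>E I A \<in> sets (PiM I (\<lambda>_. M))"
      using \<open>finite I\<close> A_meas by (rule sets_PiM_I_finite)
    have prod_meas: "(\<lambda>x. \<Prod>i\<in>I. g i (x i)) \<in> borel_measurable (PiM I (\<lambda>_. M))"
      using g by (intro borel_measurable_prod_ennreal measurable_compose[OF measurable_component_singleton])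
    have "emeasure (density (PiM I (\<lambda>_. M)) (\<lambda>x. \<Prod>i\<in>I. g i (x i))) (Pi\<^sub>E I A)
        = (\<integral>\<^sup>+x. (\<Prod>i\<in>I. g i (x i)) * indicator (Pi\<^sub>E I A) x \<partial>PiM I (\<lambda>_. M))"
      using prod_meas box by (rule emeasure_density)
    also have "\<dots> = (\<integral>\<^sup>+x. (\<Prod>i\<in>I. g i (x i) * indicator (A i) (x i)) \<partial>PiM I (\<lambda>_. M))"
    proof (rule nn_integral_cong)
      fix x assume "x \<in> space (PiM I (\<lambda>_. M))"
      then have "indicator (Pi\<^sub>E I A) x = (\<Prod>i\<in>I. indicator (A i) (x i) :: ennreal)"
        using \<open>finite I\<close> by (auto simp: space_PiM PiE_iff indicator_def)
      then show "(\<Prod>i\<in>I. g i (x i)) * indicator (Pi\<^sub>E I A) x = (\<Prod>i\<in>I. g i (x i) * indicator (A i) (x i))"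
        by (simp add: prod.distrib)
    qed
    also have "\<dots> = (\<Prod>i\<in>I. \<integral>\<^sup>+y. g i y * indicator (A i) y \<partial>M)"
      using \<open>finite I\<close> g A_meas
      by (intro M.product_nn_integral_prod borel_measurable_times_ennreal borel_measurable_indicator) auto
    also have "\<dots> = (\<Prod>i\<in>I. emeasure (N i) (A i))"
      using g A_meas by (intro prod.cong refl) (simp add: N_def emeasure_density)
    finally show "emeasure (density (PiM I (\<lambda>_. M)) (\<lambda>x. \<Prod>i\<in>I. g i (x i))) (Pi\<^sub>E I A)
      = (\<Prod>i\<in>I. emeasure (N i) (A i))" .
  qed
  also have "PiM I N = PiM I (\<lambda>i. density M (g i))"
    by (rule PiM_cong) (auto simp: N_def)
  finally show ?thesis by simp
qed

subsection \<open>Selection of sparse vectors\<close>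

definition support :: "nat \<Rightarrow> (nat \<Rightarrow> nat) \<Rightarrow> nat set" where
  "support d \<eta> = {j \<in> {1..d}. \<eta> j \<noteq> 0}"

lemma binary_vectors_value:
  assumes "\<eta> \<in> binary_vectors d" "j \<in> {1..d}"
  shows "\<eta> j = (if j \<in> support d \<eta> then 1 else 0)"
  using assms unfolding binary_vectors_def support_def by (auto dest!: PiE_mem[where x = j])

lemma finite_binary_vectors: "finite (binary_vectors d)"
  unfolding binary_vectors_def by (rule finite_PiE) auto

lemma num_nonzero_eq_card_support: "num_nonzero d \<eta> = card (support d \<eta>)"
  unfolding num_nonzero_def support_def ..

text \<open>The inverse takes a set to its indicator vector. This reindexes sums over sparse vectors
  as sums over \<open>s\<close>-element subsets, the setting of the finite loss inequality.\<close>

lemma bij_betw_support: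
  "bij_betw (support d) {\<eta> \<in> binary_vectors d. num_nonzero d \<eta> = s} {A. A \<subseteq> {1..d} \<and> card A = s}"
proof (rule bij_betwI[where g = "\<lambda>A. \<lambda>j\<in>{1..d}. of_bool (j \<in> A)"])
  have sup: "support d (\<lambda>j\<in>{1..d}. of_bool (j \<in> A)) = A" if "A \<subseteq> {1..d}" for A
    using that by (auto simp: support_def)
  show "(\<lambda>A. \<lambda>j\<in>{1..d}. of_bool (j \<in> A))
      \<in> {A. A \<subseteq> {1..d} \<and> card A = s} \<rightarrow> {\<eta> \<in> binary_vectors d. num_nonzero d \<eta> = s}"
    by (auto simp: num_nonzero_eq_card_support sup simp del: One_nat_def) (auto simp: binary_vectors_def)
  show "support d (\<lambda>j\<in>{1..d}. of_bool (j \<in> A)) = A" if "A \<in> {A. A \<subseteq> {1..d} \<and> card A = s}" for A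
    using that sup by simp
  show "support d \<in> {\<eta> \<in> binary_vectors d. num_nonzero d \<eta> = s} \<rightarrow> {A. A \<subseteq> {1..d} \<and> card A = s}"
    by (auto simp: num_nonzero_eq_card_support) (auto simp: support_def)
  show "(\<lambda>j\<in>{1..d}. of_bool (j \<in> support d \<eta>)) = \<eta>"
    if "\<eta> \<in> {\<eta> \<in> binary_vectors d. num_nonzero d \<eta> = s}" for \<eta>
  proof
    fix j
    show "(\<lambda>j\<in>{1..d}. of_bool (j \<in> support d \<eta>)) j = \<eta> j"
      using that binary_vectors_value[of \<eta> d j] by (auto simp: binary_vectors_def PiE_iff extensional_def)
  qed
qed

lemma hamming_eq_card_sym_diff:
  assumes "\<eta> \<in> binary_vectors d" "\<eta>' \<in> binary_vectors d"
  shows "hamming d \<eta> \<eta>' = real (card (sym_diff (support d \<eta>) (support d \<eta>')))"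
proof -
  have "hamming d \<eta> \<eta>' = real (card {j \<in> {1..d}. \<eta> j \<noteq> \<eta>' j})"
    by (simp add: hamming_def of_bool_def sum.inter_filter[symmetric])
  also have "{j \<in> {1..d}. \<eta> j \<noteq> \<eta>' j} = sym_diff (support d \<eta>) (support d \<eta>')"
  proof (intro set_eqI)
    fix j
    show "j \<in> {j \<in> {1..d}. \<eta> j \<noteq> \<eta>' j} \<longleftrightarrow> j \<in> sym_diff (support d \<eta>) (support d \<eta>')"
    proof (cases "j \<in> {1..d}")
      case True
      show ?thesis
        using binary_vectors_value[OF assms(1) True] binary_vectors_value[OF assms(2) True] True
        by (cases "j \<in> support d \<eta>"; cases "j \<in> support d \<eta>'") simp_all
    qed (auto simp: support_def)
  qed
  finally show ?thesis .
qed

lemma hamming_nonneg: "0 \<le> hamming d \<eta> \<eta>'"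
  by (simp add: hamming_def sum_nonneg)

lemma hamming_le: "hamming d \<eta> \<eta>' \<le> real d"
proof -
  have "hamming d \<eta> \<eta>' \<le> (\<Sum>j = 1..d. 1)"
    unfolding hamming_def by (intro sum_mono) simp
  then show ?thesis by simp
qed

lemma first_ones_mem:
  assumes "s \<le> d"
  shows "first_ones d s \<in> {\<eta> \<in> binary_vectors d. num_nonzero d \<eta> = s}"
proof -
  have "{j \<in> {1..d}. first_ones d s j \<noteq> 0} = {1..s}"
    using assms by (auto simp: first_ones_def)
  then show ?thesis by (auto simp: num_nonzero_def binary_vectors_def first_ones_def)
qed

text \<open>The permutation is glued from a bijection of the support onto \<open>{1..s}\<close> and
  one of its complement onto \<open>{s<..d}\<close>.\<close>

lemma first_ones_permuted:
  assumes "\<eta> \<in> binary_vectors d" "num_nonzero d \<eta> = s" "s \<le> d"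
  obtains \<pi> where "bij_betw \<pi> {1..d} {1..d}" "\<And>j. j \<in> {1..d} \<Longrightarrow> \<eta> j = first_ones d s (\<pi> j)"
proof -
  let ?A = "support d \<eta>"
  have sub: "?A \<subseteq> {1..d}" by (auto simp: support_def)
  have card: "card ?A = s" using assms by (simp add: num_nonzero_eq_card_support)
  have fin: "finite ?A" using sub finite_subset by blast
  obtain f where f: "bij_betw f ?A {1..s}"
    using finite_same_card_bij[of ?A "{1..s}"] fin card by auto
  have "card ({1..d} - ?A) = card {s<..d}"
    using sub card fin by (simp add: card_Diff_subset)
  then obtain g where g: "bij_betw g ({1..d} - ?A) {s<..d}"
    using finite_same_card_bij[of "{1..d} - ?A" "{s<..d}"] by auto
  define \<pi> where "\<pi> = (\<lambda>j. if j \<in> ?A then f j else g j)"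
  have "bij_betw \<pi> (?A \<union> ({1..d} - ?A)) ({1..s} \<union> {s<..d})"
  proof (rule bij_betw_combine)
    show "bij_betw \<pi> ?A {1..s}" using f by (simp add: \<pi>_def cong: bij_betw_cong)
    show "bij_betw \<pi> ({1..d} - ?A) {s<..d}"
      using g by (subst bij_betw_cong[where g = g]) (auto simp: \<pi>_def)
  qed auto
  moreover have "?A \<union> ({1..d} - ?A) = {1..d}" "{1..s} \<union> {s<..d} = {1..d}"
    using sub assms(3) by auto
  ultimately have bij: "bij_betw \<pi> {1..d} {1..d}" by simp
  have "\<eta> j = first_ones d s (\<pi> j)" if j: "j \<in> {1..d}" for j
  proof (cases "j \<in> ?A")
    case True
    then have "\<pi> j \<in> {1..s}" using bij_betw_apply[OF f] by (simp add: \<pi>_def)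
    then show ?thesis using binary_vectors_value[OF assms(1) j] True assms(3) by (simp add: first_ones_def)
  next
    case False
    then have "\<pi> j \<in> {s<..d}" using bij_betw_apply[OF g] j by (simp add: \<pi>_def)
    then show ?thesis using binary_vectors_value[OF assms(1) j] False by (simp add: first_ones_def)
  qed
  with bij show thesis using that by blast
qed

text \<open>Sorting depends only on the multiset of values, which a permutation of the indices
  leaves unchanged.\<close>

lemma s_largest_permuted:
  assumes "bij_betw \<pi> {1..d} {1..d}"
  shows "s_largest d s (\<lambda>i. L (\<pi> i)) = s_largest d s L"
proof -
  have "image_mset \<pi> (mset_set {1..d}) = mset_set {1..d}"
    using assms by (simp add: image_mset_mset_set bij_betw_def)
  moreover have "mset [1..<Suc d] = mset_set {1..d}"
    by (simp only: mset_upt atLeastLessThanSuc_atLeastAtMost)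
  moreover have "mset (map (\<lambda>i. L (\<pi> i)) [1..<Suc d]) = image_mset L (image_mset \<pi> (mset [1..<Suc d]))"
    by (simp only: mset_map image_mset.compositionality comp_def)
  ultimately have "mset (sort (map L [1..<Suc d])) = mset (map (\<lambda>i. L (\<pi> i)) [1..<Suc d])"
    by (simp only: mset_map mset_sort)
  then have "sort (map (\<lambda>i. L (\<pi> i)) [1..<Suc d]) = sort (map L [1..<Suc d])"
    by (rule properties_for_sort[OF _ sorted_sort])
  then show ?thesis unfolding s_largest_def by (simp only:)
qed

section \<open>Likelihoods with respect to the law of pure \<open>P0\<close> observations\<close>

locale pivotal_selection =
  fixes M P0 P1 :: "'a measure" and f0 f1 :: "'a \<Rightarrow> real" and d s :: nat
  assumes s_le: "s \<le> d"
    and prob_P0: "prob_space P0" and prob_P1: "prob_space P1"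
    and sets_P0: "sets P0 = sets M"
    and meas_f0: "f0 \<in> borel_measurable M" and meas_f1: "f1 \<in> borel_measurable M"
    and ratio_nonneg: "\<And>x. x \<in> space M \<Longrightarrow> 0 \<le> f1 x / f0 x"
    and P1_eq: "P1 = density P0 (\<lambda>x. ennreal (f1 x / f0 x))"
    and distinct_ratios: "\<And>\<eta>. \<eta> \<in> binary_vectors d \<Longrightarrow> num_nonzero d \<eta> = s \<Longrightarrow>
          AE x in obs_law d P0 P1 \<eta>. inj_on (lik_ratio f0 f1 x) {1..d}"
begin

abbreviation "Q \<equiv> PiM {1..d} (\<lambda>_. P0)"
abbreviation "scan \<equiv> scan_selector d s f0 f1"
abbreviation "sparse_vectors \<equiv> {\<eta> \<in> binary_vectors d. num_nonzero d \<eta> = s}"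

text \<open>The likelihood of \<eta> relative to \<open>Q\<close>; under the uniform prior on sparse
  vectors it is the posterior weight up to normalisation.\<close>

definition weight :: "(nat \<Rightarrow> nat) \<Rightarrow> (nat \<Rightarrow> 'a) \<Rightarrow> real" where
  "weight \<eta> x = (\<Prod>j\<in>support d \<eta>. lik_ratio f0 f1 x j)"

lemma space_P0: "space P0 = space M"
  using sets_P0 by (rule sets_eq_imp_space_eq)

lemma sets_obs_law: "sets (obs_law d P0 P1 \<eta>) = sets (PiM {1..d} (\<lambda>_. M))"
  unfolding obs_law_def by (rule sets_PiM_cong) (auto simp: P1_eq sets_P0)

lemma sets_Q: "sets Q = sets (PiM {1..d} (\<lambda>_. M))"
  by (rule sets_PiM_cong) (auto simp: sets_P0)

lemma prob_obs_law: "prob_space (obs_law d P0 P1 \<eta>)"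
  unfolding obs_law_def using prob_P0 prob_P1 by (intro prob_space_PiM) auto

lemma ratio_meas: "(\<lambda>y. f1 y / f0 y) \<in> borel_measurable P0"
  using meas_f0 meas_f1 unfolding measurable_cong_sets[OF sets_P0 refl] by (rule borel_measurable_divide[rotated])

lemma lik_ratio_meas:
  assumes "i \<in> {1..d}"
  shows "(\<lambda>x. lik_ratio f0 f1 x i) \<in> borel_measurable Q"
  unfolding lik_ratio_def
  by (rule measurable_compose[OF measurable_component_singleton[OF assms] ratio_meas])

lemma lik_ratio_nonneg: "x \<in> space Q \<Longrightarrow> i \<in> {1..d} \<Longrightarrow> 0 \<le> lik_ratio f0 f1 x i"
  unfolding lik_ratio_def by (rule ratio_nonneg) (auto simp: space_PiM PiE_iff space_P0)

lemma weight_meas: "weight \<eta> \<in> borel_measurable Q"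
  unfolding weight_def by (intro borel_measurable_prod lik_ratio_meas) (auto simp: support_def)

lemma weight_nonneg: "x \<in> space Q \<Longrightarrow> 0 \<le> weight \<eta> x"
  unfolding weight_def by (intro prod_nonneg ballI lik_ratio_nonneg) (auto simp: support_def)

text \<open>Coordinate \<open>j\<close> has density \<open>f1 / f0\<close> with respect to
  \<open>P0\<close> if it carries a signal and density 1 otherwise, so only the factors in the
  support remain in the product.\<close>

lemma obs_law_eq_density:
  assumes "\<eta> \<in> binary_vectors d"
  shows "obs_law d P0 P1 \<eta> = density Q (\<lambda>x. ennreal (weight \<eta> x))"
proof -
  define g where "g = (\<lambda>j y. if \<eta> j = 1 then ennreal (f1 y / f0 y) else 1)"
  have dens: "(if \<eta> j = 1 then P1 else P0) = density P0 (g j)" for j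
    by (simp add: g_def P1_eq density_1)
  have "obs_law d P0 P1 \<eta> = PiM {1..d} (\<lambda>j. density P0 (g j))"
    unfolding obs_law_def dens ..
  also have "\<dots> = density Q (\<lambda>x. \<Prod>j\<in>{1..d}. g j (x j))"
  proof (rule PiM_density)
    show "sigma_finite_measure P0"
      using prob_P0 by (rule prob_space_imp_sigma_finite)
    show "g j \<in> borel_measurable P0" for j
      using ratio_meas by (simp add: g_def)
    have "prob_space (density P0 (g j))" for j
      using prob_P0 prob_P1 unfolding dens[symmetric] by simp
    then show "sigma_finite_measure (density P0 (g j))" for j
      by (rule prob_space_imp_sigma_finite)
  qed simp
  also have "\<dots> = density Q (\<lambda>x. ennreal (weight \<eta> x))"
  proof (rule density_cong)
    show "(\<lambda>x. \<Prod>j\<in>{1..d}. g j (x j)) \<in> borel_measurable Q"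
      using ratio_meas
      by (intro borel_measurable_prod_ennreal measurable_compose[OF measurable_component_singleton])
         (auto simp: g_def)
    show "(\<lambda>x. ennreal (weight \<eta> x)) \<in> borel_measurable Q"
      using weight_meas by (rule measurable_compose[OF _ measurable_ennreal])
    show "AE x in Q. (\<Prod>j\<in>{1..d}. g j (x j)) = ennreal (weight \<eta> x)"
    proof (rule AE_I2)
      fix x assume x: "x \<in> space Q"
      have "(\<Prod>j\<in>{1..d}. g j (x j)) = (\<Prod>j\<in>{1..d}. if j \<in> support d \<eta> then ennreal (lik_ratio f0 f1 x j) else 1)"
        by (rule prod.cong) (auto simp: g_def lik_ratio_def binary_vectors_value[OF assms])
      also have "\<dots> = (\<Prod>j\<in>support d \<eta>. ennreal (lik_ratio f0 f1 x j))"
        by (subst prod.inter_filter[symmetric]) (auto intro!: prod.cong simp: support_def)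
      also have "\<dots> = ennreal (weight \<eta> x)"
        unfolding weight_def by (rule prod_ennreal) (use x lik_ratio_nonneg in \<open>auto simp: support_def\<close>)
      finally show "(\<Prod>j\<in>{1..d}. g j (x j)) = ennreal (weight \<eta> x)" .
    qed
  qed
  finally show ?thesis .
qed

section \<open>Measurability and permutation symmetry of the scan selector\<close>

lemma scan_meas: "scan \<in> PiM {1..d} (\<lambda>_. M) \<rightarrow>\<^sub>M count_space (binary_vectors d)"
proof -
  have "scan \<in> Q \<rightarrow>\<^sub>M count_space (binary_vectors d)"
    unfolding measurable_count_space_eq2[OF finite_binary_vectors]
  proof (intro conjI ballI)
    show "scan \<in> space Q \<rightarrow> binary_vectors d"
      by (auto simp: scan_selector_def binary_vectors_def)
    fix a assume a: "a \<in> binary_vectors d"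
    have selected: "{x \<in> space Q. lik_ratio f0 f1 x i \<in> s_largest d s (lik_ratio f0 f1 x)} \<in> sets Q"
      if i: "i \<in> {1..d}" for i
    proof -
      \<comment> \<open>The number of strictly larger ratios, written as a sum of indicators, is
        measurable; coordinate \<open>i\<close> is selected exactly when this number is below
        \<open>s\<close>.\<close>
      have meas: "(\<lambda>x. \<Sum>j\<in>{1..d}. if lik_ratio f0 f1 x i < lik_ratio f0 f1 x j then 1 else 0 :: real)
          \<in> borel_measurable Q"
        using i lik_ratio_meas
        by (intro borel_measurable_sum measurable_If borel_measurable_const borel_measurable_less) auto
      have "{x \<in> space Q. lik_ratio f0 f1 x i \<in> s_largest d s (lik_ratio f0 f1 x)}
          = {x \<in> space Q. (\<Sum>j\<in>{1..d}. if lik_ratio f0 f1 x i < lik_ratio f0 f1 x j then 1 else 0 :: real) < real s}"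
        using mem_s_largest_iff[OF i] by (simp add: sum.inter_filter[symmetric])
      then show ?thesis using meas by simp
    qed
    have "scan -` {a} \<inter> space Q = {x \<in> space Q. \<forall>i\<in>{1..d}. scan x i = a i}"
      using a by (auto simp: scan_selector_def binary_vectors_def PiE_iff intro!: extensionalityI[where A = "{1..d}"])
    also have "\<dots> \<in> sets Q"
    proof (rule sets.sets_Collect_finite_All)
      fix i assume i: "i \<in> {1..d}"
      have "{x \<in> space Q. scan x i = a i} =
        (if a i = 1 then {x \<in> space Q. lik_ratio f0 f1 x i \<in> s_largest d s (lik_ratio f0 f1 x)}
         else space Q - {x \<in> space Q. lik_ratio f0 f1 x i \<in> s_largest d s (lik_ratio f0 f1 x)})"
        using i binary_vectors_value[OF a i] by (auto simp: scan_selector_def split: if_splits)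
      then show "{x \<in> space Q. scan x i = a i} \<in> sets Q"
        using selected[OF i] by auto
    qed simp
    finally show "scan -` {a} \<inter> space Q \<in> sets Q" .
  qed
  then show ?thesis unfolding measurable_cong_sets[OF sets_Q refl] .
qed

lemma hamming_scan_meas: "(\<lambda>x. hamming d (scan x) \<eta>) \<in> borel_measurable (obs_law d P0 P1 \<eta>')"
  unfolding measurable_cong_sets[OF sets_obs_law refl]
  by (rule measurable_compose[OF scan_meas]) simp

text \<open>A relabelling of the coordinates carries the law under \<open>first_ones d s\<close> to
  the law under \<eta>, and the scan selector is relabelled in the same way. The loss is preserved
  at every sample, even one with ties.\<close>

lemma scan_risk_symmetric:
  assumes "\<eta> \<in> sparse_vectors"
  shows "(\<integral>x. hamming d (scan x) \<eta> \<partial>obs_law d P0 P1 \<eta>)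
       = (\<integral>x. hamming d (scan x) (first_ones d s) \<partial>obs_law d P0 P1 (first_ones d s))"
proof -
  let ?e = "first_ones d s"
  obtain \<pi> where bij: "bij_betw \<pi> {1..d} {1..d}" and \<eta>: "\<And>j. j \<in> {1..d} \<Longrightarrow> \<eta> j = ?e (\<pi> j)"
    using first_ones_permuted assms s_le by blast
  have maps: "\<pi> j \<in> {1..d}" if "j \<in> {1..d}" for j using bij_betw_apply[OF bij that] .
  define N where "N = (\<lambda>j. if ?e j = 1 then P1 else P0)"
  \<comment> \<open>Coordinate \<open>j\<close> of \<open>T x\<close> is coordinate
    \<open>\<pi> j\<close> of \<open>x\<close> and has law \<open>N (\<pi> j)\<close>, which is the
    law prescribed by \<open>\<eta> j\<close>.\<close>
  define T where "T = (\<lambda>x :: nat \<Rightarrow> 'a. \<lambda>j\<in>{1..d}. x (\<pi> j))"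
  have law: "obs_law d P0 P1 \<eta> = PiM {1..d} (\<lambda>j. N (\<pi> j))"
    unfolding obs_law_def N_def by (rule PiM_cong) (auto simp: \<eta>)
  have "distr (PiM {1..d} N) (PiM {1..d} (\<lambda>j. N (\<pi> j))) T = PiM {1..d} (\<lambda>j. N (\<pi> j))"
    unfolding T_def
    using prob_P0 prob_P1 bij maps by (intro distr_PiM_reindex) (auto simp: N_def bij_betw_def)
  then have distr: "obs_law d P0 P1 \<eta> = distr (obs_law d P0 P1 ?e) (obs_law d P0 P1 \<eta>) T"
    unfolding law by (simp add: obs_law_def N_def)
  have T_meas: "T \<in> obs_law d P0 P1 ?e \<rightarrow>\<^sub>M obs_law d P0 P1 \<eta>"
    unfolding T_def measurable_cong_sets[OF sets_obs_law sets_obs_law]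
    by (intro measurable_restrict measurable_component_singleton maps)
  have inv: "hamming d (scan (T x)) \<eta> = hamming d (scan x) ?e" for x
  proof -
    have "s_largest d s (lik_ratio f0 f1 (T x)) = s_largest d s (\<lambda>i. lik_ratio f0 f1 x (\<pi> i))"
      by (rule s_largest_cong) (simp add: lik_ratio_def T_def)
    also have "\<dots> = s_largest d s (lik_ratio f0 f1 x)"
      using bij by (rule s_largest_permuted)
    finally have "scan (T x) j = scan x (\<pi> j)" if "j \<in> {1..d}" for j
      using that maps[OF that] by (simp add: scan_selector_def T_def lik_ratio_def)
    then have "hamming d (scan (T x)) \<eta> = (\<Sum>j\<in>{1..d}. of_bool (scan x (\<pi> j) \<noteq> ?e (\<pi> j)))"
      unfolding hamming_def using \<eta> by (intro sum.cong) auto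
    also have "\<dots> = hamming d (scan x) ?e"
      unfolding hamming_def by (rule sum.reindex_bij_betw[OF bij])
    finally show ?thesis .
  qed
  have "(\<integral>x. hamming d (scan x) \<eta> \<partial>obs_law d P0 P1 \<eta>)
      = (\<integral>x. hamming d (scan (T x)) \<eta> \<partial>obs_law d P0 P1 ?e)"
    by (subst distr, rule integral_distr[OF T_meas hamming_scan_meas])
  then show ?thesis by (simp only: inv)
qed

section \<open>Comparison of posterior losses at a fixed sample\<close>

lemma scan_loss_le_twice:
  assumes x: "x \<in> space Q" and inj: "inj_on (lik_ratio f0 f1 x) {1..d}" and v: "v \<in> binary_vectors d"
  shows "(\<Sum>\<eta>\<in>sparse_vectors. weight \<eta> x * hamming d (scan x) \<eta>) \<le> 2 * (\<Sum>\<eta>\<in>sparse_vectors. weight \<eta> x * hamming d v \<eta>)"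
proof -
  let ?L = "lik_ratio f0 f1 x"
  let ?loss = "\<lambda>B. \<Sum>A | A \<subseteq> {1..d} \<and> card A = s. prod ?L A * real (card (sym_diff B A))"
  have loss: "(\<Sum>\<eta>\<in>sparse_vectors. weight \<eta> x * hamming d u \<eta>) = ?loss (support d u)"
    if u: "u \<in> binary_vectors d" for u
  proof -
    have "(\<Sum>\<eta>\<in>sparse_vectors. weight \<eta> x * hamming d u \<eta>)
        = (\<Sum>\<eta>\<in>sparse_vectors. prod ?L (support d \<eta>) * real (card (sym_diff (support d u) (support d \<eta>))))"
      using u by (intro sum.cong) (auto simp: weight_def hamming_eq_card_sym_diff)
    also have "\<dots> = ?loss (support d u)"
      by (rule sum.reindex_bij_betw[OF bij_betw_support])
    finally show ?thesis .
  qed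
  have scan: "scan x \<in> binary_vectors d"
    by (auto simp: scan_selector_def binary_vectors_def)
  have supp: "support d (scan x) = {i \<in> {1..d}. ?L i \<in> s_largest d s ?L}"
    by (auto simp: support_def scan_selector_def)
  have "?loss (support d (scan x)) \<le> 2 * ?loss (support d v)"
  proof (rule top_set_loss_le_twice)
    show "0 \<le> ?L k" if "k \<in> {1..d}" for k using lik_ratio_nonneg[OF x that] .
    show "card (support d (scan x)) = s"
      unfolding supp using inj s_le by (rule card_top_indices)
    fix i j assume i: "i \<in> support d (scan x)" and j: "j \<in> {1..d} - support d (scan x)"
    show "?L j \<le> ?L i"
    \<comment> \<open>If an unselected \<open>j\<close> had a larger ratio than a selected
      \<open>i\<close>, every index above \<open>j\<close> would also be above \<open>i\<close>, so
      fewer than \<open>s\<close> indices would exceed \<open>j\<close> and \<open>j\<close> would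
      be selected.\<close>
    proof (rule ccontr)
      assume "\<not> ?L j \<le> ?L i"
      then have "card {k \<in> {1..d}. ?L j < ?L k} \<le> card {k \<in> {1..d}. ?L i < ?L k}"
        by (intro card_mono) auto
      also have "\<dots> < s" using i mem_s_largest_iff[of i d ?L s] unfolding supp by simp
      finally show False using j mem_s_largest_iff[of j d ?L s] unfolding supp by auto
    qed
  qed (auto simp: support_def)
  then show ?thesis using loss[OF scan] loss[OF v] by simp
qed

text \<open>Ties are null under the sparse laws but perhaps not under \<open>Q\<close>. At
  \<open>Q\<close>-almost every sample with ties, however, all sparse weights vanish and both sides
  are 0. The quantifier over \<open>v\<close> stands inside the almost-everywhere statement so that
  \<open>v\<close> may later depend on the sample and the randomization.\<close>

lemma AE_scan_loss_le_twice:
  "AE x in Q. \<forall>v\<in>binary_vectors d.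
     (\<Sum>\<eta>\<in>sparse_vectors. weight \<eta> x * hamming d (scan x) \<eta>) \<le> 2 * (\<Sum>\<eta>\<in>sparse_vectors. weight \<eta> x * hamming d v \<eta>)"
proof -
  have fin: "finite sparse_vectors" using finite_binary_vectors by simp
  have "AE x in Q. 0 < ennreal (weight \<eta> x) \<longrightarrow> inj_on (lik_ratio f0 f1 x) {1..d}" if "\<eta> \<in> sparse_vectors" for \<eta>
  proof -
    have "AE x in obs_law d P0 P1 \<eta>. inj_on (lik_ratio f0 f1 x) {1..d}"
      using that by (intro distinct_ratios) auto
    moreover have "obs_law d P0 P1 \<eta> = density Q (\<lambda>x. ennreal (weight \<eta> x))"
      using that by (intro obs_law_eq_density) auto
    ultimately have "AE x in density Q (\<lambda>x. ennreal (weight \<eta> x)). inj_on (lik_ratio f0 f1 x) {1..d}"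
      by (simp only:)
    then show ?thesis
      unfolding AE_density[OF measurable_compose[OF weight_meas measurable_ennreal]] .
  qed
  then have "AE x in Q. \<forall>\<eta>\<in>sparse_vectors. 0 < ennreal (weight \<eta> x) \<longrightarrow> inj_on (lik_ratio f0 f1 x) {1..d}"
    by (rule AE_finite_allI[OF fin])
  then show ?thesis
  proof (rule AE_mp, intro AE_I2 impI ballI)
    fix x v
    assume x: "x \<in> space Q" and v: "v \<in> binary_vectors d"
      and inj: "\<forall>\<eta>\<in>sparse_vectors. 0 < ennreal (weight \<eta> x) \<longrightarrow> inj_on (lik_ratio f0 f1 x) {1..d}"
    show "(\<Sum>\<eta>\<in>sparse_vectors. weight \<eta> x * hamming d (scan x) \<eta>) \<le> 2 * (\<Sum>\<eta>\<in>sparse_vectors. weight \<eta> x * hamming d v \<eta>)"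
    proof (cases "inj_on (lik_ratio f0 f1 x) {1..d}")
      case True
      then show ?thesis using scan_loss_le_twice x v by blast
    next
      case False
      then have "weight \<eta> x = 0" if "\<eta> \<in> sparse_vectors" for \<eta>
        using inj that weight_nonneg[OF x, of \<eta>] by fastforce
      then show ?thesis by simp
    qed
  qed
qed


section \<open>Risks of randomized selectors\<close>

lemma selector_loss_meas:
  assumes "(Z, \<phi>) \<in> selectors d M"
  shows "(\<lambda>w. hamming d (\<phi> w) \<eta>) \<in> borel_measurable (obs_law d P0 P1 \<eta>' \<Otimes>\<^sub>M Z)"
    and "(\<lambda>w. hamming d (\<phi> w) \<eta>) \<in> borel_measurable (Q \<Otimes>\<^sub>M Z)"
proof -
  have "\<phi> \<in> PiM {1..d} (\<lambda>_. M) \<Otimes>\<^sub>M Z \<rightarrow>\<^sub>M count_space (binary_vectors d)"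
    using assms by (simp add: selectors_def)
  then have meas: "(\<lambda>w. hamming d (\<phi> w) \<eta>) \<in> borel_measurable (PiM {1..d} (\<lambda>_. M) \<Otimes>\<^sub>M Z)"
    by (rule measurable_compose) simp
  show "(\<lambda>w. hamming d (\<phi> w) \<eta>) \<in> borel_measurable (obs_law d P0 P1 \<eta>' \<Otimes>\<^sub>M Z)"
    using meas unfolding measurable_cong_sets[OF sets_pair_measure_cong[OF sets_obs_law refl] refl] .
  show "(\<lambda>w. hamming d (\<phi> w) \<eta>) \<in> borel_measurable (Q \<Otimes>\<^sub>M Z)"
    using meas unfolding measurable_cong_sets[OF sets_pair_measure_cong[OF sets_Q refl] refl] .
qed

lemma scan_selector_mem:
  assumes "prob_space Z"
  shows "(Z, \<lambda>w. scan (fst w)) \<in> selectors d M"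
  using assms measurable_compose[OF measurable_fst scan_meas] by (simp add: selectors_def)

lemma scan_selector_risk:
  assumes "prob_space Z"
  shows "selector_risk d P0 P1 \<eta> (Z, \<lambda>w. scan (fst w)) = (\<integral>x. hamming d (scan x) \<eta> \<partial>obs_law d P0 P1 \<eta>)"
proof -
  let ?P = "obs_law d P0 P1 \<eta>"
  have "(\<integral>x. hamming d (scan x) \<eta> \<partial>?P) = (\<integral>x. hamming d (scan x) \<eta> \<partial>distr (?P \<Otimes>\<^sub>M Z) ?P fst)"
    by (simp only: prob_space.distr_pair_fst[OF assms])
  also have "\<dots> = (\<integral>w. hamming d (scan (fst w)) \<eta> \<partial>(?P \<Otimes>\<^sub>M Z))"
    by (rule integral_distr[OF measurable_fst hamming_scan_meas])
  finally show ?thesis by (simp add: selector_risk_def)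
qed

text \<open>Change of measure: the risks for all \<eta> become integrals over the same space
  \<open>Q \<Otimes>\<^sub>M Z\<close>, so that they can be added under one integral sign.\<close>

lemma selector_risk_eq_weighted:
  assumes T: "(Z, \<phi>) \<in> selectors d M" and \<eta>: "\<eta> \<in> binary_vectors d"
  shows "integrable (Q \<Otimes>\<^sub>M Z) (\<lambda>w. weight \<eta> (fst w) * hamming d (\<phi> w) \<eta>)"
    and "selector_risk d P0 P1 \<eta> (Z, \<phi>) = (\<integral>w. weight \<eta> (fst w) * hamming d (\<phi> w) \<eta> \<partial>(Q \<Otimes>\<^sub>M Z))"
proof -
  let ?P = "obs_law d P0 P1 \<eta>"
  interpret Z: prob_space Z using T by (simp add: selectors_def)
  interpret P: prob_space ?P by (rule prob_obs_law)
  interpret PZ: pair_prob_space ?P Z ..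
  \<comment> \<open>Writing \<open>Z\<close> with constant density 1 brings the product into the
    form of the rule for products of densities.\<close>
  have "?P \<Otimes>\<^sub>M Z = density Q (\<lambda>x. ennreal (weight \<eta> x)) \<Otimes>\<^sub>M density Z (\<lambda>_. 1)"
    using obs_law_eq_density[OF \<eta>] by (simp add: density_1)
  also have "\<dots> = density (Q \<Otimes>\<^sub>M Z) (\<lambda>(x, z). ennreal (weight \<eta> x) * 1)"
    using weight_meas Z.sigma_finite_measure_axioms
    by (intro pair_measure_density) (auto simp: density_1)
  finally have law: "?P \<Otimes>\<^sub>M Z = density (Q \<Otimes>\<^sub>M Z) (\<lambda>w. ennreal (weight \<eta> (fst w)))"
    by (simp add: case_prod_unfold)
  have wm: "(\<lambda>w. weight \<eta> (fst w)) \<in> borel_measurable (Q \<Otimes>\<^sub>M Z)"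
    by (rule measurable_compose[OF measurable_fst weight_meas])
  have nn: "AE w in Q \<Otimes>\<^sub>M Z. 0 \<le> weight \<eta> (fst w)"
    by (rule AE_I2) (auto simp: space_pair_measure intro: weight_nonneg)
  \<comment> \<open>The loss lies between 0 and \<open>d\<close>, hence is integrable under a
    probability law; integrability of the weighted loss follows by the change of measure.\<close>
  have "integrable (?P \<Otimes>\<^sub>M Z) (\<lambda>w. hamming d (\<phi> w) \<eta>)"
    using selector_loss_meas(1)[OF T]
    by (intro PZ.P.integrable_const_bound[where B = "real d"]) (auto simp: hamming_nonneg hamming_le)
  then show "integrable (Q \<Otimes>\<^sub>M Z) (\<lambda>w. weight \<eta> (fst w) * hamming d (\<phi> w) \<eta>)"
    unfolding law using integrable_density[OF selector_loss_meas(2)[OF T] wm nn] by simp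
  show "selector_risk d P0 P1 \<eta> (Z, \<phi>) = (\<integral>w. weight \<eta> (fst w) * hamming d (\<phi> w) \<eta> \<partial>(Q \<Otimes>\<^sub>M Z))"
    unfolding selector_risk_def using integral_density[OF selector_loss_meas(2)[OF T] wm nn]
    by (simp add: law)
qed

text \<open>Integrates the comparison at a fixed sample with \<open>v\<close> taken as the output of
  \<phi>. The sums are Bayes risks under the uniform prior, multiplied by the number of sparse
  vectors. The scan selector is given the same \<open>Z\<close>, so both sides live on one
  space.\<close>

lemma sum_scan_risk_le_twice:
  assumes T: "(Z, \<phi>) \<in> selectors d M"
  shows "(\<Sum>\<eta>\<in>sparse_vectors. selector_risk d P0 P1 \<eta> (Z, \<lambda>w. scan (fst w)))
       \<le> 2 * (\<Sum>\<eta>\<in>sparse_vectors. selector_risk d P0 P1 \<eta> (Z, \<phi>))"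
proof -
  interpret Z: prob_space Z using T by (simp add: selectors_def)
  have scan_mem: "(Z, \<lambda>w. scan (fst w)) \<in> selectors d M"
    using Z.prob_space_axioms by (rule scan_selector_mem)
  have total: "(\<Sum>\<eta>\<in>sparse_vectors. selector_risk d P0 P1 \<eta> (Z, \<psi>))
      = (\<integral>w. (\<Sum>\<eta>\<in>sparse_vectors. weight \<eta> (fst w) * hamming d (\<psi> w) \<eta>) \<partial>(Q \<Otimes>\<^sub>M Z))"
    and int: "integrable (Q \<Otimes>\<^sub>M Z) (\<lambda>w. \<Sum>\<eta>\<in>sparse_vectors. weight \<eta> (fst w) * hamming d (\<psi> w) \<eta>)"
    if \<psi>: "(Z, \<psi>) \<in> selectors d M" for \<psi>
  proof -
    show "integrable (Q \<Otimes>\<^sub>M Z) (\<lambda>w. \<Sum>\<eta>\<in>sparse_vectors. weight \<eta> (fst w) * hamming d (\<psi> w) \<eta>)"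
      by (intro Bochner_Integration.integrable_sum selector_risk_eq_weighted(1)[OF \<psi>]) simp
    have "(\<Sum>\<eta>\<in>sparse_vectors. selector_risk d P0 P1 \<eta> (Z, \<psi>))
        = (\<Sum>\<eta>\<in>sparse_vectors. \<integral>w. weight \<eta> (fst w) * hamming d (\<psi> w) \<eta> \<partial>(Q \<Otimes>\<^sub>M Z))"
      by (intro sum.cong refl selector_risk_eq_weighted(2)[OF \<psi>]) simp
    also have "\<dots> = (\<integral>w. (\<Sum>\<eta>\<in>sparse_vectors. weight \<eta> (fst w) * hamming d (\<psi> w) \<eta>) \<partial>(Q \<Otimes>\<^sub>M Z))"
      by (intro Bochner_Integration.integral_sum[symmetric] selector_risk_eq_weighted(1)[OF \<psi>]) simp
    finally show "(\<Sum>\<eta>\<in>sparse_vectors. selector_risk d P0 P1 \<eta> (Z, \<psi>))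
      = (\<integral>w. (\<Sum>\<eta>\<in>sparse_vectors. weight \<eta> (fst w) * hamming d (\<psi> w) \<eta>) \<partial>(Q \<Otimes>\<^sub>M Z))" .
  qed
  have \<phi>_space: "\<phi> w \<in> binary_vectors d" if "w \<in> space (Q \<Otimes>\<^sub>M Z)" for w
  proof -
    have "space Q = space (PiM {1..d} (\<lambda>_. M))" by (rule sets_eq_imp_space_eq[OF sets_Q])
    then have w: "w \<in> space (PiM {1..d} (\<lambda>_. M) \<Otimes>\<^sub>M Z)"
      using that by (simp only: space_pair_measure)
    have "\<phi> \<in> PiM {1..d} (\<lambda>_. M) \<Otimes>\<^sub>M Z \<rightarrow>\<^sub>M count_space (binary_vectors d)"
      using T by (simp add: selectors_def)
    from measurable_space[OF this w] show ?thesis by (simp only: space_count_space)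
  qed
  \<comment> \<open>Viewing \<open>Q\<close> as the law of the first component lifts the
    almost-everywhere statement from \<open>Q\<close> to
    \<open>Q \<Otimes>\<^sub>M Z\<close>.\<close>
  have "AE x in distr (Q \<Otimes>\<^sub>M Z) Q fst. \<forall>v\<in>binary_vectors d.
     (\<Sum>\<eta>\<in>sparse_vectors. weight \<eta> x * hamming d (scan x) \<eta>)
       \<le> 2 * (\<Sum>\<eta>\<in>sparse_vectors. weight \<eta> x * hamming d v \<eta>)"
    unfolding Z.distr_pair_fst by (rule AE_scan_loss_le_twice)
  from AE_distrD[OF measurable_fst this]
  have "AE w in Q \<Otimes>\<^sub>M Z. (\<Sum>\<eta>\<in>sparse_vectors. weight \<eta> (fst w) * hamming d (scan (fst w)) \<eta>)
       \<le> 2 * (\<Sum>\<eta>\<in>sparse_vectors. weight \<eta> (fst w) * hamming d (\<phi> w) \<eta>)"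
    by (rule AE_mp) (use \<phi>_space in \<open>auto intro!: AE_I2\<close>)
  then have "(\<integral>w. (\<Sum>\<eta>\<in>sparse_vectors. weight \<eta> (fst w) * hamming d (scan (fst w)) \<eta>) \<partial>(Q \<Otimes>\<^sub>M Z))
      \<le> (\<integral>w. 2 * (\<Sum>\<eta>\<in>sparse_vectors. weight \<eta> (fst w) * hamming d (\<phi> w) \<eta>) \<partial>(Q \<Otimes>\<^sub>M Z))"
    using int[OF scan_mem] int[OF T] by (intro integral_mono_AE integrable_mult_right)
  also have "\<dots> = 2 * (\<integral>w. (\<Sum>\<eta>\<in>sparse_vectors. weight \<eta> (fst w) * hamming d (\<phi> w) \<eta>) \<partial>(Q \<Otimes>\<^sub>M Z))"
    by (rule integral_mult_right_zero)
  finally show ?thesis unfolding total[OF scan_mem] total[OF T] .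
qed

section \<open>From Bayes risk to minimax risk\<close>

lemma scan_minimax_bounds:
  defines "scan_risk \<equiv> (\<integral>x. hamming d (scan x) (first_ones d s) \<partial>obs_law d P0 P1 (first_ones d s))"
    and "minimax_risk \<equiv> (INF T \<in> (selectors d M :: ('a, 'z) selector set).
             SUP \<eta> \<in> sparse_vectors. selector_risk d P0 P1 \<eta> T)"
  shows "1 / 2 * scan_risk \<le> minimax_risk \<and> minimax_risk \<le> scan_risk"
proof -
  let ?worst = "\<lambda>T :: ('a, 'z) selector. SUP \<eta> \<in> sparse_vectors. selector_risk d P0 P1 \<eta> T"
  have fin: "finite sparse_vectors" using finite_binary_vectors by simp
  have ne: "first_ones d s \<in> sparse_vectors" using s_le by (rule first_ones_mem)
  have scan_risk: "selector_risk d P0 P1 \<eta> (Z, \<lambda>w. scan (fst w)) = scan_risk"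
    if "prob_space Z" "\<eta> \<in> sparse_vectors" for Z :: "'z measure" and \<eta>
    unfolding scan_selector_risk[OF that(1)] scan_risk_def by (rule scan_risk_symmetric[OF that(2)])
  have lower: "1 / 2 * scan_risk \<le> ?worst T" if T: "T \<in> selectors d M" for T
  proof -
    obtain Z \<phi> where T_eq: "T = (Z, \<phi>)" by (cases T)
    have Z: "prob_space Z" using T by (simp add: T_eq selectors_def)
    let ?n = "real (card sparse_vectors)"
    have "?n * scan_risk = (\<Sum>\<eta>\<in>sparse_vectors. selector_risk d P0 P1 \<eta> (Z, \<lambda>w. scan (fst w)))"
      using scan_risk[OF Z] by simp
    also have "\<dots> \<le> 2 * (\<Sum>\<eta>\<in>sparse_vectors. selector_risk d P0 P1 \<eta> T)"
      using sum_scan_risk_le_twice T unfolding T_eq by blast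
    \<comment> \<open>The passage from the uniform prior to the worst case: each of the
      \<open>?n\<close> risks is at most the supremum.\<close>
    also have "(\<Sum>\<eta>\<in>sparse_vectors. selector_risk d P0 P1 \<eta> T) \<le> (\<Sum>\<eta>\<in>sparse_vectors. ?worst T)"
      using fin by (intro sum_mono cSUP_upper) auto
    finally have "?n * scan_risk \<le> ?n * (2 * ?worst T)" by simp
    moreover have "0 < ?n" using fin ne by (simp add: card_gt_0_iff) blast
    ultimately show ?thesis by simp
  qed
  \<comment> \<open>The scan selector ignores its randomization, so any probability law on
    \<open>'z\<close> would do; a point mass exists on every type. This also makes the set of
    selectors non-empty.\<close>
  define Z0 where "Z0 = (return (count_space UNIV) undefined :: 'z measure)"
  have Z0: "prob_space Z0" unfolding Z0_def by (rule prob_space_return) simp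
  have mem: "(Z0, \<lambda>w. scan (fst w)) \<in> selectors d M" using Z0 by (rule scan_selector_mem)
  have "1 / 2 * scan_risk \<le> minimax_risk"
    unfolding minimax_risk_def using mem lower by (intro cINF_greatest) auto
  \<comment> \<open>A real infimum is below its members only if the set is bounded below;
    \<open>lower\<close> supplies that bound.\<close>
  moreover have "minimax_risk \<le> ?worst (Z0, \<lambda>w. scan (fst w))"
    unfolding minimax_risk_def using lower by (intro cINF_lower[OF bdd_belowI2 mem])
  moreover have "?worst (Z0, \<lambda>w. scan (fst w)) \<le> scan_risk"
    using ne scan_risk[OF Z0] by (intro cSUP_least) auto
  ultimately show ?thesis by linarith
qed

end

section \<open>From densities with respect to \<mu> to the likelihood ratio as a density\<close>

theorem theorem4:
  fixes \<mu> P0 P1 :: "'a measure" and f0 f1 :: "'a \<Rightarrow> real" and d s :: nat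
  assumes "2 \<le> s" and "s < d"
    and "prob_space P0" and "prob_space P1" and "P0 \<noteq> P1"
    and "f0 \<in> borel_measurable \<mu>" and "f1 \<in> borel_measurable \<mu>"
    and "\<forall>x\<in>space \<mu>. 0 \<le> f0 x" and "\<forall>x\<in>space \<mu>. 0 \<le> f1 x"
    and "P0 = density \<mu> (\<lambda>x. ennreal (f0 x))" and "P1 = density \<mu> (\<lambda>x. ennreal (f1 x))"
    and lik_ratio_well_defined: "\<forall>\<eta>\<in>binary_vectors d.
           AE x in obs_law d P0 P1 \<eta>. \<forall>i\<in>{1..d}. f0 (x i) \<noteq> 0"
    and no_ties: "\<forall>\<eta>\<in>binary_vectors d. num_nonzero d \<eta> = s \<longrightarrow>
           \<P>(x in obs_law d P0 P1 \<eta>. \<forall>i\<in>{1..d}. \<forall>j\<in>{1..d}. i \<noteq> j \<longrightarrow>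
              lik_ratio f0 f1 x i \<noteq> lik_ratio f0 f1 x j) = 1"
  defines "scan_risk \<equiv> (\<integral>x. hamming d (scan_selector d s f0 f1 x) (first_ones d s)
             \<partial>obs_law d P0 P1 (first_ones d s))"
    and "minimax_risk \<equiv> (INF T \<in> (selectors d \<mu> :: ('a, 'z) selector set).
             SUP \<eta> \<in> {\<eta> \<in> binary_vectors d. num_nonzero d \<eta> = s}. selector_risk d P0 P1 \<eta> T)"
  shows "1 / 2 * scan_risk \<le> minimax_risk \<and> minimax_risk \<le> scan_risk"
proof -
  note f0[measurable] = assms(6) and f1[measurable] = assms(7) and nonneg = assms(8,9)
  note P0 = assms(10) and P1 = assms(11)
  have prob: "prob_space (if c then P1 else P0)" for c using assms(3,4) by simp
  \<comment> \<open>The all-ones vector makes every coordinate distributed as \<open>P1\<close>;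
    well-definedness of the ratios under it, projected to the first coordinate, says that
    \<open>P1\<close> does not charge the zeros of \<open>f0\<close>.\<close>
  have f0_ne: "AE y in P1. f0 y \<noteq> 0"
  proof -
    let ?one = "\<lambda>j\<in>{1..d}. 1 :: nat"
    have comp: "1 \<in> {1..d}" using assms(1,2) by simp
    have law: "obs_law d P0 P1 ?one = PiM {1..d} (\<lambda>_. P1)"
      unfolding obs_law_def by (rule PiM_cong) auto
    have "?one \<in> binary_vectors d" by (auto simp: binary_vectors_def)
    from bspec[OF lik_ratio_well_defined this]
    have "AE x in PiM {1..d} (\<lambda>_. P1). \<forall>i\<in>{1..d}. f0 (x i) \<noteq> 0"
      unfolding law .
    then have first: "AE x in PiM {1..d} (\<lambda>_. P1). f0 (x 1) \<noteq> 0"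
      by (rule AE_mp) (use comp in \<open>auto intro!: AE_I2\<close>)
    have "{y \<in> space P1. f0 y \<noteq> 0} \<in> sets P1"
      using f0 unfolding P1 by simp
    then have "AE y in distr (PiM {1..d} (\<lambda>_. P1)) P1 (\<lambda>x. x 1). f0 y \<noteq> 0"
      by (rule AE_distr_iff[OF measurable_component_singleton[OF comp], THEN iffD2]) (rule first)
    moreover have "distr (PiM {1..d} (\<lambda>_. P1)) P1 (\<lambda>x. x 1) = P1"
      using assms(4) comp by (intro distr_PiM_component)
    ultimately show ?thesis by (simp only:)
  qed
  have P1_eq: "P1 = density P0 (\<lambda>x. ennreal (f1 x / f0 x))"
  proof -
    have "AE x in \<mu>. 0 < ennreal (f1 x) \<longrightarrow> f0 x \<noteq> 0"
      using f0_ne f1 unfolding P1 by (subst (asm) AE_density) auto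
    \<comment> \<open>Where \<open>f0\<close> vanishes, \<open>f1\<close> vanishes almost everywhere
      too, and the identity reads \<open>0 = 0\<close>; elsewhere \<open>f0\<close> cancels.\<close>
    then have "AE x in \<mu>. ennreal (f1 x) = ennreal (f0 x) * ennreal (f1 x / f0 x)"
    proof (rule AE_mp, intro AE_I2 impI)
      fix x assume x: "x \<in> space \<mu>" and pos: "0 < ennreal (f1 x) \<longrightarrow> f0 x \<noteq> 0"
      have "0 \<le> f0 x" "0 \<le> f1 x" using nonneg x by auto
      then show "ennreal (f1 x) = ennreal (f0 x) * ennreal (f1 x / f0 x)"
        using pos by (cases "f0 x = 0") (auto simp: ennreal_mult[symmetric])
    qed
    then have "P1 = density \<mu> (\<lambda>x. ennreal (f0 x) * ennreal (f1 x / f0 x))"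
      unfolding P1 by (intro density_cong) auto
    also have "\<dots> = density P0 (\<lambda>x. ennreal (f1 x / f0 x))"
      unfolding P0 by (intro density_density_eq[symmetric]) auto
    finally show ?thesis .
  qed
  interpret pivotal_selection \<mu> P0 P1 f0 f1 d s
  proof (rule pivotal_selection.intro)
    show "s \<le> d" using assms(2) by simp
    show "sets P0 = sets \<mu>" unfolding P0 by simp
    show "0 \<le> f1 x / f0 x" if "x \<in> space \<mu>" for x
      using nonneg that by (intro divide_nonneg_nonneg) auto
    fix \<eta> assume \<eta>: "\<eta> \<in> binary_vectors d" "num_nonzero d \<eta> = s"
    interpret P: prob_space "obs_law d P0 P1 \<eta>"
      unfolding obs_law_def by (rule prob_space_PiM) (rule prob)
    let ?A = "{x \<in> space (obs_law d P0 P1 \<eta>). \<forall>i\<in>{1..d}. \<forall>j\<in>{1..d}. i \<noteq> j \<longrightarrow>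
              lik_ratio f0 f1 x i \<noteq> lik_ratio f0 f1 x j}"
    have one: "P.prob ?A = 1" by (rule mp[OF bspec[OF no_ties \<eta>(1)] \<eta>(2)])
    \<comment> \<open>\<open>measure\<close> is 0 on non-measurable sets, so probability 1 already
      forces the no-ties set to be an event.\<close>
    have "?A \<in> P.events"
    proof (rule ccontr)
      assume "?A \<notin> P.events"
      from measure_notin_sets[OF this] one show False by linarith
    qed
    from iffD1[OF P.prob_eq_1[OF this] one]
    have "AE x in obs_law d P0 P1 \<eta>. x \<in> ?A" .
    then show "AE x in obs_law d P0 P1 \<eta>. inj_on (lik_ratio f0 f1 x) {1..d}"
      by (rule AE_mp) (auto intro!: AE_I2 simp: inj_on_def)
  qed (fact assms(3) assms(4) f0 f1 P1_eq)+
  show ?thesis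
    unfolding scan_risk_def minimax_risk_def by (rule scan_minimax_bounds)
qed

end
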